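(* Let $\rho\in[0,1)$. Every Banach space with ACK$_\rho$-structure is a universal pointwise BPB range space.
   Context: Banach spaces are over $\mathbb{K}$, where $\mathbb{K}=\mathbb{R}$ or $\mathbb{K}=\mathbb{C}$. $\mathcal{L}(X,Y)$ is the Banach space of bounded linear operators from $X$ to $Y$; $B_X$, $S_X$ are the closed unit ball and unit sphere of $X$; $\mathrm{aconv}(A)$ is the absolutely convex hull of $A$. A pair $(X,Y)$ of Banach spaces has the pointwise BPB property if for every $\varepsilon>0$ there is $\eta>0$ such that whenever $T\in\mathcal{L}(X,Y)$ with $\|T\|=1$ and $x_0\in S_X$ satisfy $\|T(x_0)\|>1-\eta$, there is $S\in\mathcal{L}(X,Y)$ with $\|S\|=1$, $\|S(x_0)\|=1$ and $\|S-T\|<\varepsilon$. A Banach space $Y$ is a universal pointwise BPB range space if $(X,Y)$ has the pointwise BPB property for every uniformly smooth Banach space $X$ (that is, $\lim_{t\to0^+}\rho_X(t)/t=0$ where $\rho_X(t)=\sup\{\frac{\|x+y\|+\|x-y\|-2}{2}: \|x\|=1,\ \|y\|\leq t\}$). A set $\Gamma\subset B_{Y^*}$ is $1$-norming for $Y$ if the weak-star closure of $\mathrm{aconv}(\Gamma)$ is the whole of $B_{Y^*}$. A Banach space $Y$ has ACK-structure with parameter $\rho\in[0,1)$ (ACK$_\rho$-structure) if there is a $1$-norming set $\Gamma\subset B_{Y^*}$ such that for every $\varepsilon'>0$ and every non-empty relatively $w^*$-open subset $U\subset\Gamma$ there exist a non-empty subset $V\subset U$, vectors $y_1^*\in V$,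 $e\in S_Y$, and an operator $F\in\mathcal{L}(Y,Y)$ such that: (i) $\|F(e)\|=\|F\|=1$; (ii) $y_1^*(F(e))=1$; (iii) $F^*(y_1^* )=y_1^*$; (iv) $|y^*(F(e))|\leq\rho$ for every $y^*\in\Gamma\setminus V_1$, where $V_1=\{y^*\in\Gamma: \|F^*(y^* )\|+(1-\varepsilon')\|[\mathrm{Id}_{Y^*}-F^*](y^* )\|\leq1\}$; (v) $\mathrm{dist}(F^*(y^* ),\mathrm{aconv}\{0,V\})<\varepsilon'$ for every $y^*\in\Gamma$, where $\mathrm{aconv}\{0,V\}=\mathrm{aconv}(\{0\}\cup V)$; (vi) $|v^*(e)-1|\leq\varepsilon'$ for every $v^*\in V$. *)

theory Defs
  imports "HOL-Analysis.Analysis"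
begin

(* The scalar fields \<K>: up to isometric isomorphism exactly the real and the complex numbers. *)
class real_or_complex = real_normed_field + banach +
  fixes to_complex :: "'a \<Rightarrow> complex"
  assumes to_complex_add: "to_complex (a + b) = to_complex a + to_complex b"
    and to_complex_mult: "to_complex (a * b) = to_complex a * to_complex b"
    and to_complex_scaleR: "to_complex (scaleR r a) = scaleR r (to_complex a)"
    and norm_to_complex: "norm (to_complex a) = norm a"
    and range_to_complex: "range to_complex = \<real> \<or> range to_complex = UNIV"

instantiation real :: real_or_complex
begin
definition to_complex_real :: "real \<Rightarrow> complex" where "to_complex_real = complex_of_real"
instance
  by standard (simp_all add: to_complex_real_def Reals_def scaleR_conv_of_real)
end

instantiation complex :: real_or_complex
begin
definition to_complex_complex :: "complex \<Rightarrow> complex" where "to_complex_complex = id"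
instance
  by standard (simp_all add: to_complex_complex_def)
end

(* A Banach space over \<K>: the type carries the norm, completeness and the underlying real
   structure; the locale parameter is the \<K>-scalar multiplication. *)
locale banach_space_over = vector_space scale
  for scale :: "'k::real_or_complex \<Rightarrow> 'a::banach \<Rightarrow> 'a" +
  assumes norm_scale: "norm (scale c x) = norm c * norm x"
    and scale_of_real: "scale (of_real r) x = scaleR r x"

lemma banach_space_over_real: "banach_space_over (scaleR :: real \<Rightarrow> 'a::banach \<Rightarrow> 'a)"
  by unfold_locales (simp_all add: algebra_simps)

lemma banach_space_over_self: "banach_space_over ((*) :: 'k::real_or_complex \<Rightarrow> 'k \<Rightarrow> 'k)"
  by unfold_locales (simp_all add: algebra_simps norm_mult scaleR_conv_of_real)

(* The \<K>-linear operators among the bounded real-linear ones; the operator norm is the same. *)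
definition bounded_operators ::
    "('k \<Rightarrow> 'x \<Rightarrow> 'x) \<Rightarrow> ('k \<Rightarrow> 'y \<Rightarrow> 'y)
      \<Rightarrow> ('x::real_normed_vector \<Rightarrow>\<^sub>L 'y::real_normed_vector) set" where
  "bounded_operators sX sY = {T. \<forall>c x. blinfun_apply T (sX c x) = sY c (blinfun_apply T x)}"

definition dual_space ::
    "('k::real_or_complex \<Rightarrow> 'y \<Rightarrow> 'y) \<Rightarrow> ('y::real_normed_vector \<Rightarrow>\<^sub>L 'k) set" where
  "dual_space sY = bounded_operators sY (*)"

(* On functionals, pointwise convergence is weak-star convergence. *)
definition weak_star_topology ::
    "('k::real_or_complex \<Rightarrow> 'y \<Rightarrow> 'y) \<Rightarrow> ('y::real_normed_vector \<Rightarrow>\<^sub>L 'k) topology" where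
  "weak_star_topology sY = subtopology strong_operator_topology (dual_space sY)"

(* The functional y \<mapsto> c * f y. *)
definition dual_scale ::
    "'k::real_or_complex \<Rightarrow> ('y::real_normed_vector \<Rightarrow>\<^sub>L 'k) \<Rightarrow> ('y \<Rightarrow>\<^sub>L 'k)" where
  "dual_scale c f = blinfun_mult_right c o\<^sub>L f"

definition adjoint_op ::
    "('x::real_normed_vector \<Rightarrow>\<^sub>L 'y::real_normed_vector)
      \<Rightarrow> ('y \<Rightarrow>\<^sub>L 'k::real_or_complex) \<Rightarrow> ('x \<Rightarrow>\<^sub>L 'k)" where
  "adjoint_op F f = f o\<^sub>L F"

definition absolutely_convex ::
    "('k::real_or_complex \<Rightarrow> 'v \<Rightarrow> 'v) \<Rightarrow> 'v::real_vector set \<Rightarrow> bool" where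
  "absolutely_convex s C \<longleftrightarrow> convex C \<and> (\<forall>c. norm c \<le> 1 \<longrightarrow> (\<forall>x\<in>C. s c x \<in> C))"

definition aconv ::
    "('k::real_or_complex \<Rightarrow> 'v \<Rightarrow> 'v) \<Rightarrow> 'v::real_vector set \<Rightarrow> 'v set" where
  "aconv s A = absolutely_convex s hull A"

definition one_norming ::
    "('k::real_or_complex \<Rightarrow> 'y \<Rightarrow> 'y) \<Rightarrow> ('y::real_normed_vector \<Rightarrow>\<^sub>L 'k) set \<Rightarrow> bool" where
  "one_norming sY \<Gamma> \<longleftrightarrow>
     \<Gamma> \<subseteq> dual_space sY \<inter> cball 0 1 \<and>
     weak_star_topology sY closure_of aconv dual_scale \<Gamma> = dual_space sY \<inter> cball 0 1"

definition ACK_structure ::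
    "real \<Rightarrow> ('k::real_or_complex \<Rightarrow> 'y \<Rightarrow> 'y::real_normed_vector) \<Rightarrow> bool" where
  "ACK_structure \<rho> sY \<longleftrightarrow>
     (\<exists>\<Gamma> :: ('y \<Rightarrow>\<^sub>L 'k) set. one_norming sY \<Gamma> \<and>
       (\<forall>\<epsilon>>0. \<forall>U. openin (subtopology (weak_star_topology sY) \<Gamma>) U \<and> U \<noteq> {} \<longrightarrow>
         (\<exists>V y1 e. \<exists>F \<in> bounded_operators sY sY.
            V \<noteq> {} \<and> V \<subseteq> U \<and> y1 \<in> V \<and> norm e = 1 \<and>
            norm (blinfun_apply F e) = 1 \<and> norm F = 1 \<and>
            blinfun_apply y1 (blinfun_apply F e) = 1 \<and>
            adjoint_op F y1 = y1 \<and>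
            (let V\<^sub>1 = {f \<in> \<Gamma>. norm (adjoint_op F f) + (1 - \<epsilon>) * norm (f - adjoint_op F f) \<le> 1}
             in \<forall>f \<in> \<Gamma> - V\<^sub>1. norm (blinfun_apply f (blinfun_apply F e)) \<le> \<rho>) \<and>
            (\<forall>f\<in>\<Gamma>. infdist (adjoint_op F f) (aconv dual_scale ({0} \<union> V)) < \<epsilon>) \<and>
            (\<forall>f\<in>V. norm (blinfun_apply f e - 1) \<le> \<epsilon>))))"

definition modulus_of_smoothness :: "'x::real_normed_vector itself \<Rightarrow> real \<Rightarrow> real" where
  "modulus_of_smoothness _ t =
     Sup {(norm (x + y) + norm (x - y) - 2) / 2 | x y :: 'x. norm x = 1 \<and> norm y \<le> t}"

definition uniformly_smooth :: "'x::real_normed_vector itself \<Rightarrow> bool" where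
  "uniformly_smooth X \<longleftrightarrow> ((\<lambda>t. modulus_of_smoothness X t / t) \<longlongrightarrow> 0) (at_right 0)"

definition pointwise_BPB ::
    "('k::real_or_complex \<Rightarrow> 'x \<Rightarrow> 'x::real_normed_vector)
      \<Rightarrow> ('k \<Rightarrow> 'y \<Rightarrow> 'y::real_normed_vector) \<Rightarrow> bool" where
  "pointwise_BPB sX sY \<longleftrightarrow>
     (\<forall>\<epsilon>>0. \<exists>\<eta>>0. \<forall>T \<in> bounded_operators sX sY. \<forall>x0.
        norm T = 1 \<and> norm x0 = 1 \<and> norm (blinfun_apply T x0) > 1 - \<eta> \<longrightarrow>
        (\<exists>S \<in> bounded_operators sX sY.
           norm S = 1 \<and> norm (blinfun_apply S x0) = 1 \<and> norm (S - T) < \<epsilon>))"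

(* HOL cannot quantify over types inside a formula, so the type carrying the domain spaces is a
   parameter; a theorem schematic in 'x covers all domain spaces. *)
definition universal_pointwise_BPB_range ::
    "'x::banach itself \<Rightarrow> ('k::real_or_complex \<Rightarrow> 'y \<Rightarrow> 'y::banach) \<Rightarrow> bool" where
  "universal_pointwise_BPB_range X sY \<longleftrightarrow>
     (\<forall>sX :: 'k \<Rightarrow> 'x \<Rightarrow> 'x.
        banach_space_over sX \<and> uniformly_smooth X \<longrightarrow> pointwise_BPB sX sY)"

end

(* For uniformly smooth X a slice of the dual ball cut out by x0 has small diameter, so the functionals
   f o T with f in the weak-star open set {f in Gamma. Re (u f (T x0)) > 1 - eta}, u unimodular, are all
   close to one multiple h of a functional supporting x0. With V, y1, e, F from the ACK-structure for
   this open set, put S x = h x F e + (1 - kappa) (T x - F (T x)). Off V_1 condition (v) gives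
   f o F o T ~ f(F e) h, so f o S ~ (1 - kappa) f o T + kappa f(F e) h has norm at most
   1 - kappa + kappa rho plus an error absorbed by kappa (1 - rho); on V_1 the bound is immediate.
   Finally y1 (S x0) = h x0 has modulus 1.
   The norming property needs functionals on Y, hence the Hahn-Banach theorem, which is derived from
   the fact that a minimal sublinear functional is linear. *)

theory Submission
  imports Defs
begin

section \<open>The Hahn--Banach theorem\<close>

text \<open>Homogeneity is asked for only as an inequality with positive factors, which is easy to
  verify for infima; equality follows by applying it to the inverse factor.\<close>

definition sublinear :: "('a::real_vector \<Rightarrow> real) \<Rightarrow> bool" where
  "sublinear p \<longleftrightarrow> (\<forall>x y. p (x + y) \<le> p x + p y) \<and>
    (\<forall>a x. 0 < a \<longrightarrow> p (a *\<^sub>R x) \<le> a * p x)"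

lemma sublinear_scaleR:
  assumes "sublinear p" "0 < a"
  shows "p (a *\<^sub>R x) = a * p x"
proof (rule antisym)
  show "p (a *\<^sub>R x) \<le> a * p x"
    using assms by (simp add: sublinear_def)
  have "p (inverse a *\<^sub>R (a *\<^sub>R x)) \<le> inverse a * p (a *\<^sub>R x)"
    using assms unfolding sublinear_def by (metis inverse_positive_iff_positive)
  then show "a * p x \<le> p (a *\<^sub>R x)"
    using assms by (simp add: field_simps)
qed

lemma sublinear_zero:
  assumes "sublinear p"
  shows "p 0 = 0"
  using sublinear_scaleR[OF assms, of 2 0] by simp

lemma sublinear_scaleR_nonneg:
  assumes "sublinear p" "0 \<le> a"
  shows "p (a *\<^sub>R x) = a * p x"
  using assms sublinear_scaleR[of p a x] sublinear_zero[of p] by (cases "a = 0") auto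

lemma sublinear_add_le: "sublinear p \<Longrightarrow> p (x + y) \<le> p x + p y"
  by (simp add: sublinear_def)

lemma sublinear_ge_uminus:
  assumes "sublinear p"
  shows "- p (- x) \<le> p x"
  using sublinear_add_le[OF assms, of x "- x"] sublinear_zero[OF assms] by simp

lemma sublinear_norm: "sublinear norm"
  by (simp add: sublinear_def norm_triangle_ineq)

text \<open>The largest sublinear functional below \<open>p\<close> whose value at \<open>- y\<close> is at most \<open>- p y\<close>.\<close>
definition flatten :: "('a::real_vector \<Rightarrow> real) \<Rightarrow> 'a \<Rightarrow> 'a \<Rightarrow> real" where
  "flatten p y x = (INF t\<in>{0..}. p (x + t *\<^sub>R y) - t * p y)"

text \<open>The bound does not depend on \<open>t\<close>, so the infimum defining
  \<open>flatten\<close> is that of a set bounded below.\<close>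

lemma flatten_lower_bound:
  assumes "sublinear p" "0 \<le> t"
  shows "- p (- x) \<le> p (x + t *\<^sub>R y) - t * p y"
  using sublinear_add_le[OF assms(1), of "x + t *\<^sub>R y" "- x"] sublinear_scaleR_nonneg[OF assms, of y]
  by simp

lemma flatten_le:
  assumes "sublinear p" "0 \<le> t"
  shows "flatten p y x \<le> p (x + t *\<^sub>R y) - t * p y"
  unfolding flatten_def
  by (rule cINF_lower) (use assms flatten_lower_bound[OF assms(1)] in \<open>auto intro!: bdd_belowI2\<close>)

lemma flatten_ge:
  assumes "\<And>t. 0 \<le> t \<Longrightarrow> c \<le> p (x + t *\<^sub>R y) - t * p y"
  shows "c \<le> flatten p y x"
  unfolding flatten_def by (rule cINF_greatest) (use assms in auto)

lemma flatten_le_self: "sublinear p \<Longrightarrow> flatten p y x \<le> p x"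
  using flatten_le[of p 0 y x] by simp

text \<open>Subadditivity: near-optimal parameters \<open>s\<close> and \<open>t\<close> for the two
  summands combine to the parameter \<open>s + t\<close>. Homogeneity: rescale the parameter to
  \<open>a * t\<close>.\<close>

lemma sublinear_flatten:
  assumes p: "sublinear p"
  shows "sublinear (flatten p y)"
  unfolding sublinear_def
proof (intro conjI allI impI)
  fix x z
  have "flatten p y (x + z) - (p (x + t *\<^sub>R y) - t * p y) \<le> p (z + s *\<^sub>R y) - s * p y"
    if "0 \<le> s" "0 \<le> t" for s t
    using flatten_le[OF p, of "s + t" y "x + z"] that
      sublinear_add_le[OF p, of "x + t *\<^sub>R y" "z + s *\<^sub>R y"]
    by (simp add: algebra_simps)
  then have "flatten p y (x + z) - (p (x + t *\<^sub>R y) - t * p y) \<le> flatten p y z" if "0 \<le> t" for t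
    using that by (intro flatten_ge) auto
  then have "flatten p y (x + z) - flatten p y z \<le> p (x + t *\<^sub>R y) - t * p y" if "0 \<le> t" for t
    using that by (simp add: algebra_simps)
  then have "flatten p y (x + z) - flatten p y z \<le> flatten p y x"
    by (intro flatten_ge) auto
  then show "flatten p y (x + z) \<le> flatten p y x + flatten p y z"
    by simp
next
  fix a :: real and x assume a: "0 < a"
  have "flatten p y (a *\<^sub>R x) / a \<le> p (x + t *\<^sub>R y) - t * p y" if "0 \<le> t" for t
    using flatten_le[OF p, of "a * t" y "a *\<^sub>R x"] sublinear_scaleR[OF p a, of "x + t *\<^sub>R y"] that a
    by (simp add: field_simps scaleR_add_right)
  then have "flatten p y (a *\<^sub>R x) / a \<le> flatten p y x"
    by (intro flatten_ge) auto
  then show "flatten p y (a *\<^sub>R x) \<le> a * flatten p y x"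
    using a by (simp add: field_simps)
qed

text \<open>The pointwise infimum works: it is finite because \<open>- q (- x)\<close> bounds every
  member below, and subadditive because, of two members, the smaller one can be used at both
  points.\<close>

lemma chain_of_sublinear_has_lower_bound:
  assumes sub: "\<And>p. p \<in> C \<Longrightarrow> sublinear p"
    and le: "\<And>p x. p \<in> C \<Longrightarrow> p x \<le> q x"
    and chain: "\<And>p p'. p \<in> C \<Longrightarrow> p' \<in> C \<Longrightarrow> (\<forall>x. p x \<le> p' x) \<or> (\<forall>x. p' x \<le> p x)"
    and ne: "C \<noteq> {}"
  obtains r where "sublinear r" "\<And>p x. p \<in> C \<Longrightarrow> r x \<le> p x"
proof
  define r where "r x = (INF p\<in>C. p x)" for x
  have "- q (- x) \<le> p x" if "p \<in> C" for p x
    using sublinear_ge_uminus[OF sub[OF that], of x] le[OF that, of "- x"] by linarith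
  then show r_le: "r x \<le> p x" if "p \<in> C" for p x
    unfolding r_def using that by (intro cINF_lower bdd_belowI2) auto
  have r_ge: "c \<le> r x" if "\<And>p. p \<in> C \<Longrightarrow> c \<le> p x" for c x
    unfolding r_def using ne that by (rule cINF_greatest)
  show "sublinear r"
    unfolding sublinear_def
  proof (intro conjI allI impI)
    fix x y
    have "r (x + y) \<le> p x + p' y" if pp: "p \<in> C" "p' \<in> C" for p p'
      using chain[OF pp]
    proof
      assume "\<forall>x. p x \<le> p' x"
      then show ?thesis
        using r_le[OF pp(1), of "x + y"] sublinear_add_le[OF sub[OF pp(1)], of x y]
        by (smt (verit))
    next
      assume "\<forall>x. p' x \<le> p x"
      then show ?thesis
        using r_le[OF pp(2), of "x + y"] sublinear_add_le[OF sub[OF pp(2)], of x y]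
        by (smt (verit))
    qed
    then have "r (x + y) - p' y \<le> r x" if "p' \<in> C" for p'
      using that by (intro r_ge) (simp add: algebra_simps)
    then have "r (x + y) - r x \<le> r y"
      by (intro r_ge) (simp add: algebra_simps)
    then show "r (x + y) \<le> r x + r y"
      by simp
  next
    fix a :: real and x assume a: "0 < a"
    have "r (a *\<^sub>R x) / a \<le> p x" if "p \<in> C" for p
      using r_le[OF that, of "a *\<^sub>R x"] sublinear_scaleR[OF sub[OF that] a, of x] a
      by (simp add: field_simps)
    then have "r (a *\<^sub>R x) / a \<le> r x"
      by (intro r_ge)
    then show "r (a *\<^sub>R x) \<le> a * r x"
      using a by (simp add: field_simps)
  qed
qed

lemma linear_below_sublinear:
  assumes q: "sublinear q"
  obtains r where "linear r" "\<And>x. r x \<le> q x"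
proof -
  define A where "A = {p. sublinear p \<and> (\<forall>x. p x \<le> q x)}"
  \<comment> \<open>The order is reversed, so that the maximal element given by Zorn's lemma is a
    minimal sublinear functional.\<close>
  have "\<exists>m\<in>A. \<forall>p\<in>A. (\<forall>x. p x \<le> m x) \<longrightarrow> p = m"
  proof (rule predicate_Zorn)
    show "partial_order_on A (relation_of (\<lambda>p p'. \<forall>x. p' x \<le> p x) A)"
      by (rule partial_order_on_relation_ofI) (auto intro: order_trans simp: fun_eq_iff order_eq_iff)
  next
    fix C assume C: "C \<in> Chains (relation_of (\<lambda>p p'. \<forall>x. p' x \<le> p x) A)"
    show "\<exists>u\<in>A. \<forall>p\<in>C. \<forall>x. u x \<le> p x"
    proof (cases "C = {}")
      case True
      then show ?thesis
        using q by (auto simp: A_def)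
    next
      case False
      have CA: "sublinear p" "p x \<le> q x" if "p \<in> C" for p x
        using C that by (auto simp: Chains_def relation_of_def A_def)
      have "(\<forall>x. p x \<le> p' x) \<or> (\<forall>x. p' x \<le> p x)" if "p \<in> C" "p' \<in> C" for p p'
        using C that by (auto simp: Chains_def relation_of_def)
      with CA False obtain r where r: "sublinear r" "\<And>p x. p \<in> C \<Longrightarrow> r x \<le> p x"
        using chain_of_sublinear_has_lower_bound[of C q] by metis
      moreover from False CA(2) r(2) have "r x \<le> q x" for x
        by (meson all_not_in_conv order_trans)
      ultimately show ?thesis
        unfolding A_def by blast
    qed
  qed
  obtain m where m: "sublinear m" "\<And>x. m x \<le> q x"
    and min: "\<And>p. sublinear p \<Longrightarrow> (\<And>x. p x \<le> m x) \<Longrightarrow> p = m"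
  proof -
    from \<open>\<exists>m\<in>A. \<forall>p\<in>A. (\<forall>x. p x \<le> m x) \<longrightarrow> p = m\<close>
    obtain m where m: "m \<in> A" "\<And>p. p \<in> A \<Longrightarrow> (\<And>x. p x \<le> m x) \<Longrightarrow> p = m"
      by blast
    have "p = m" if "sublinear p" "\<And>x. p x \<le> m x" for p
      using that m(1) by (intro m(2)) (auto simp: A_def intro: order_trans)
    with m(1) show thesis
      using that by (auto simp: A_def)
  qed
  \<comment> \<open>Flattening only decreases \<open>m\<close>, so minimality makes it trivial. Its
    bound at parameter 1 then reads as superadditivity of \<open>m\<close>.\<close>
  have "flatten m y = m" for y
    by (intro min sublinear_flatten flatten_le_self m)
  then have "m x + m y \<le> m (x + y)" for x y
    using flatten_le[OF m(1), of 1 y x] by simp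
  then have add: "m (x + y) = m x + m y" for x y
    using sublinear_add_le[OF m(1), of x y] by (simp add: antisym)
  have neg: "m (- x) = - m x" for x
    using add[of x "- x"] sublinear_zero[OF m(1)] by simp
  have "m (a *\<^sub>R x) = a * m x" for a x
    using sublinear_scaleR_nonneg[OF m(1), of a x] sublinear_scaleR_nonneg[OF m(1), of "- a" x] neg[of "a *\<^sub>R x"]
    by (cases "0 \<le> a") auto
  with add have "linear m"
    by (intro linearI) auto
  with m(2) show thesis
    using that by blast
qed

text \<open>Linearity below \<open>flatten norm y\<close> instead of below \<open>norm\<close>
  forces \<open>r (- y) \<le> - norm y\<close>, hence equality at \<open>y\<close>.\<close>

lemma real_norming_functional:
  fixes y :: "'a::real_normed_vector"
  obtains r :: "'a \<Rightarrow> real" where "linear r" "\<And>x. r x \<le> norm x" "r y = norm y"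
proof -
  obtain r where r: "linear r" "\<And>x. r x \<le> flatten norm y x"
    using linear_below_sublinear[OF sublinear_flatten[OF sublinear_norm]] by blast
  have le: "r x \<le> norm x" for x
    using r(2)[of x] flatten_le_self[OF sublinear_norm, of y x] by linarith
  have "r (- y) \<le> - norm y"
    using r(2)[of "- y"] flatten_le[OF sublinear_norm, of 1 y "- y"] by simp
  with le[of y] r(1) have "r y = norm y"
    by (simp add: linear_neg)
  with r le show thesis
    using that by blast
qed

section \<open>Scalars\<close>

text \<open>Passing through the embedding treats real and complex scalars alike.\<close>

definition Re_part :: "'k::real_or_complex \<Rightarrow> real" where
  "Re_part c = Re (to_complex c)"

lemma bounded_linear_Re_part: "bounded_linear (Re_part :: 'k::real_or_complex \<Rightarrow> real)"
proof (rule bounded_linear_intro[where K = 1])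
  fix c :: 'k
  show "norm (Re_part c) \<le> norm c * 1"
    using abs_Re_le_cmod[of "to_complex c"] by (simp add: Re_part_def norm_to_complex)
qed (simp_all add: Re_part_def to_complex_add to_complex_scaleR)

lemmas Re_part_add = linear_add[OF bounded_linear.linear[OF bounded_linear_Re_part]]
lemmas Re_part_diff = linear_diff[OF bounded_linear.linear[OF bounded_linear_Re_part]]

lemma Re_part_le_norm: "Re_part c \<le> norm c"
  using complex_Re_le_cmod[of "to_complex c"] by (simp add: Re_part_def norm_to_complex)

text \<open>An additive map that preserves norms is injective.\<close>

lemma to_complex_eq_iff: "to_complex a = to_complex b \<longleftrightarrow> a = b"
proof -
  have "to_complex (a - b) + to_complex b = to_complex a"
    by (metis diff_add_cancel to_complex_add)
  then have "to_complex (a - b) = to_complex a - to_complex b"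
    by (rule eq_diff_eq[THEN iffD2])
  then have "norm (a - b) = norm (to_complex a - to_complex b)"
    by (metis norm_to_complex)
  then show ?thesis
    by auto
qed

text \<open>The image of 1 is an idempotent complex number of norm 1, hence equal to 1; real
  homogeneity does the rest.\<close>

lemma to_complex_of_real: "to_complex (of_real r :: 'k::real_or_complex) = of_real r"
proof -
  have "to_complex (1::'k) * to_complex (1::'k) = to_complex (1 * 1 :: 'k)"
    by (rule to_complex_mult[symmetric])
  moreover have "norm (to_complex (1::'k)) = 1"
    by (simp add: norm_to_complex)
  ultimately have "to_complex (1::'k) = 1"
    by auto
  then show ?thesis
    by (simp add: of_real_def to_complex_scaleR)
qed

lemma Re_part_of_real: "Re_part (of_real r) = r"
  by (simp add: Re_part_def to_complex_of_real)

text \<open>The value \<open>0\<close> of \<open>J\<close> covers the real scalars, so that no case distinction on the field is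
  needed afterwards.\<close>
lemma imaginary_unit:
  obtains J :: "'k::real_or_complex"
  where "J = 0 \<or> J * J = - 1" "\<And>b. Re_part (J * of_real b) = 0"
    "\<And>c. \<exists>a b. c = of_real a + J * of_real b"
proof (cases "range (to_complex :: 'k \<Rightarrow> complex) = \<real>")
  case True
  have "\<exists>a b. c = of_real a + 0 * of_real b" for c :: 'k
  proof -
    obtain a where "to_complex c = of_real a"
      using True by (metis Reals_cases rangeI)
    then have "c = of_real a"
      by (metis to_complex_eq_iff to_complex_of_real)
    then show ?thesis
      by auto
  qed
  then show thesis
    using that[of 0] Re_part_of_real[of 0, where 'a='k] by simp
next
  case False
  then have "range (to_complex :: 'k \<Rightarrow> complex) = UNIV"
    using range_to_complex by blast
  then obtain J :: 'k where J: "to_complex J = \<i>"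
    by (metis surj_def)
  have "to_complex (J * J) = to_complex (of_real (- 1) :: 'k)"
    unfolding to_complex_mult J to_complex_of_real by simp
  then have "J * J = - 1"
    unfolding to_complex_eq_iff by simp
  moreover have "Re_part (J * of_real b) = 0" for b
    by (simp add: Re_part_def to_complex_mult to_complex_of_real J)
  moreover have "c = of_real (Re (to_complex c)) + J * of_real (Im (to_complex c))" for c
    by (subst to_complex_eq_iff[symmetric])
      (simp add: to_complex_add to_complex_mult to_complex_of_real J complex_eq mult.commute)
  ultimately show thesis
    using that[of J] by blast
qed

lemma unimodular_phase:
  fixes c :: "'k::real_or_complex"
  obtains u :: 'k where "norm u = 1" "u * c = of_real (norm c)"
proof (cases "c = 0")
  case True
  then show thesis
    using that[of 1] by simp
next
  case False
  then show thesis
    using that[of "of_real (norm c) / c"] by (simp add: norm_divide)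
qed

section \<open>Functionals: evaluation rules, phase rotation, and norming functionals over both
  fields\<close>

lemma dual_scale_apply: "blinfun_apply (dual_scale c f) x = c * blinfun_apply f x"
  by (simp add: dual_scale_def)

lemma adjoint_op_apply: "blinfun_apply (adjoint_op F f) x = blinfun_apply f (blinfun_apply F x)"
  by (simp add: adjoint_op_def)

lemma dual_spaceD: "f \<in> dual_space s \<Longrightarrow> blinfun_apply f (s c x) = c * blinfun_apply f x"
  by (simp add: dual_space_def bounded_operators_def)

lemma bounded_operatorsD:
  "T \<in> bounded_operators sX sY \<Longrightarrow> blinfun_apply T (sX c x) = sY c (blinfun_apply T x)"
  by (simp add: bounded_operators_def)

text \<open>Multiplying \<open>x\<close> by a unimodular scalar makes \<open>f x\<close> real and
  non-negative without changing the norm of \<open>x\<close>.\<close>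

lemma norm_le_of_Re_part_le:
  fixes f :: "'a::banach \<Rightarrow> 'k::real_or_complex"
  assumes "banach_space_over s" "\<And>c x. f (s c x) = c * f x" "\<And>x. Re_part (f x) \<le> b * norm x"
  shows "norm (f x) \<le> b * norm x"
proof -
  obtain u where u: "norm u = 1" "u * f x = of_real (norm (f x))"
    by (rule unimodular_phase)
  then have "norm (f x) = Re_part (f (s u x))"
    by (simp add: assms(2) Re_part_of_real)
  also have "\<dots> \<le> b * norm (s u x)"
    by (rule assms(3))
  also have "\<dots> = b * norm x"
    using u by (simp add: banach_space_over.norm_scale[OF assms(1)])
  finally show ?thesis .
qed

text \<open>A complex functional is recovered from its real part \<open>r\<close> as \<open>r x - \<i> r (\<i> x)\<close>.\<close>
lemma norming_functional:
  fixes sY :: "'k::real_or_complex \<Rightarrow> 'y::banach \<Rightarrow> 'y" and y :: 'y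
  assumes "banach_space_over sY"
  obtains f :: "'y \<Rightarrow>\<^sub>L 'k"
  where "f \<in> dual_space sY" "norm f \<le> 1" "Re_part (blinfun_apply f y) = norm y"
proof -
  interpret Y: banach_space_over sY by fact
  obtain J :: 'k where J: "J = 0 \<or> J * J = - 1" "\<And>b. Re_part (J * of_real b) = 0"
    and J_span: "\<And>c. \<exists>a b. c = of_real a + J * of_real b"
    by (rule imaginary_unit) blast
  obtain r :: "'y \<Rightarrow> real" where r: "linear r" "\<And>x. r x \<le> norm x" "r y = norm y"
    using real_norming_functional[of y] by blast
  define f where "f x = of_real (r x) - J * of_real (r (sY J x))" for x
  have Re_f: "Re_part (f x) = r x" for x
    by (simp add: f_def Re_part_diff Re_part_of_real J(2))
  have f_add: "f (x + z) = f x + f z" for x z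
    by (simp add: f_def linear_add[OF r(1)] Y.scale_right_distrib algebra_simps)
  have f_scale: "f (sY c x) = c * f x" for c x
  proof -
    obtain a b where c: "c = of_real a + J * of_real b"
      using J_span by blast
    have cx: "sY c x = a *\<^sub>R x + b *\<^sub>R sY J x"
      unfolding c Y.scale_left_distrib Y.scale_of_real mult.commute[of J]
      by (simp add: Y.scale_of_real flip: Y.scale_scale)
    have "sY J (sY c x) = sY c (sY J x)"
      by (simp add: mult.commute)
    also have "\<dots> = a *\<^sub>R sY J x + b *\<^sub>R sY (J * J) x"
      unfolding c Y.scale_left_distrib Y.scale_of_real mult.commute[of J "of_real b"]
      by (simp add: Y.scale_of_real flip: Y.scale_scale)
    finally have Jcx: "sY J (sY c x) = a *\<^sub>R sY J x + b *\<^sub>R sY (J * J) x" .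
    have "f (sY c x) = of_real (a * r x + b * r (sY J x)) - J * of_real (a * r (sY J x) + b * r (sY (J * J) x))"
      unfolding f_def Jcx unfolding cx by (simp add: linear_add[OF r(1)] linear_scale[OF r(1)])
    \<comment> \<open>For real scalars the terms with \<open>J\<close> vanish; for complex ones
      \<open>J * J = - 1\<close> turns \<open>r (sY (J * J) x)\<close> into
      \<open>- r x\<close>.\<close>
    moreover have "\<dots> = c * f x"
      using J(1)
    proof
      assume "J = 0"
      then show ?thesis
        by (simp add: c f_def linear_0[OF r(1)])
    next
      assume JJ: "J * J = - 1"
      have JJ': "J * (J * z) = - z" for z
        unfolding mult.assoc[symmetric] JJ by simp
      show ?thesis
        by (simp add: c f_def JJ JJ' linear_neg[OF r(1)] algebra_simps)
    qed
    ultimately show ?thesis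
      by simp
  qed
  have f_norm: "norm (f x) \<le> 1 * norm x" for x
    by (rule norm_le_of_Re_part_le[OF assms f_scale]) (simp add: Re_f r(2))
  have "bounded_linear f"
  proof (rule bounded_linear_intro[where K = 1])
    show "f (a *\<^sub>R x) = a *\<^sub>R f x" for a x
      using f_scale[of "of_real a" x] by (simp add: Y.scale_of_real scaleR_conv_of_real)
  qed (use f_add f_norm in auto)
  then have app: "blinfun_apply (Blinfun f) = f"
    by (rule bounded_linear_Blinfun_apply)
  show thesis
  proof
    show "Blinfun f \<in> dual_space sY"
      by (simp add: dual_space_def bounded_operators_def app f_scale)
    show "norm (Blinfun f) \<le> 1"
      using f_norm by (intro norm_blinfun_bound) (auto simp: app)
    show "Re_part (blinfun_apply (Blinfun f) y) = norm y"
      by (simp add: app Re_f r(3))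
  qed
qed

section \<open>Absolutely convex hulls and norming sets\<close>

text \<open>The preimage of a ball under such a map is absolutely convex, so it contains the hull of
  \<open>A\<close> as soon as it contains \<open>A\<close>.\<close>

lemma aconv_norm_le:
  fixes \<phi> :: "('y::real_normed_vector \<Rightarrow>\<^sub>L 'k::real_or_complex) \<Rightarrow> 'w::real_normed_vector"
  assumes "linear \<phi>" "\<And>c f. norm (\<phi> (dual_scale c f)) \<le> norm c * norm (\<phi> f)"
    and "\<And>f. f \<in> A \<Longrightarrow> norm (\<phi> f) \<le> b" "0 \<le> b" "v \<in> aconv dual_scale A"
  shows "norm (\<phi> v) \<le> b"
proof -
  have "convex (\<phi> -` cball 0 b)"
    using assms(1) by (intro convex_linear_vimage convex_cball)
  moreover have "norm (\<phi> (dual_scale c f)) \<le> b" if "norm c \<le> 1" "norm (\<phi> f) \<le> b" for c f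
    using assms(2)[of c f] mult_left_le_one_le[of "norm (\<phi> f)" "norm c"] that by fastforce
  ultimately have "absolutely_convex dual_scale (\<phi> -` cball 0 b)"
    by (simp add: absolutely_convex_def)
  then have "aconv dual_scale A \<subseteq> \<phi> -` cball 0 b"
    unfolding aconv_def using assms(3) by (intro hull_minimal) auto
  then show ?thesis
    using assms(5) by auto
qed

text \<open>A bound on evaluations at \<open>y\<close> passes from \<open>\<Gamma>\<close> to its
  absolutely convex hull and to the weak-star closure. That closure is the dual ball, which contains
  a functional norming \<open>y\<close>.\<close>

lemma one_norming_norm_le:
  fixes sY :: "'k::real_or_complex \<Rightarrow> 'y::banach \<Rightarrow> 'y"
  assumes Y: "banach_space_over sY" and \<Gamma>: "one_norming sY \<Gamma>"
    and "0 \<le> b" "\<And>f. f \<in> \<Gamma> \<Longrightarrow> norm (blinfun_apply f y) \<le> b"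
  shows "norm y \<le> b"
proof -
  let ?C = "{f \<in> topspace strong_operator_topology. blinfun_apply f y \<in> cball (0::'k) b}"
  obtain f :: "'y \<Rightarrow>\<^sub>L 'k" where f: "f \<in> dual_space sY" "norm f \<le> 1"
      "Re_part (blinfun_apply f y) = norm y"
    using norming_functional[OF Y] by blast
  have "closedin strong_operator_topology ?C"
    by (rule closedin_continuous_map_preimage[OF strong_operator_topology_continuous_evaluation]) simp
  moreover have "aconv dual_scale \<Gamma> \<subseteq> ?C"
  proof
    fix v assume v: "v \<in> aconv dual_scale \<Gamma>"
    have "linear (\<lambda>f :: 'y \<Rightarrow>\<^sub>L 'k. blinfun_apply f y)"
      by (intro linearI) (auto simp: blinfun.bilinear_simps)
    from aconv_norm_le[OF this _ assms(4,3) v] show "v \<in> ?C"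
      by (auto simp: strong_operator_topology_topspace dual_scale_apply norm_mult)
  qed
  ultimately have "strong_operator_topology closure_of aconv dual_scale \<Gamma> \<subseteq> ?C"
    by (rule closure_of_minimal[rotated])
  moreover have "f \<in> weak_star_topology sY closure_of aconv dual_scale \<Gamma>"
    using \<Gamma> f by (simp add: one_norming_def)
  then have "f \<in> strong_operator_topology closure_of aconv dual_scale \<Gamma>"
    unfolding weak_star_topology_def by (rule subsetD[OF closure_of_subtopology_subset])
  ultimately have "norm (blinfun_apply f y) \<le> b"
    by auto
  with f(3) Re_part_le_norm[of "blinfun_apply f y"] show ?thesis
    by simp
qed

text \<open>Slices are preimages of open sets of scalars under evaluation at \<open>y\<close>. They
  supply the open set to which the ACK condition is applied.\<close>

lemma openin_weak_star_slice:
  fixes \<Gamma> :: "('y::real_normed_vector \<Rightarrow>\<^sub>L 'k::real_or_complex) set"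
  assumes "\<Gamma> \<subseteq> dual_space sY"
  shows "openin (subtopology (weak_star_topology sY) \<Gamma>) {f \<in> \<Gamma>. a < Re_part (u * blinfun_apply f y)}"
proof -
  have "continuous_on UNIV (\<lambda>c. Re_part (u * c))"
    by (intro linear_continuous_on bounded_linear_compose[OF bounded_linear_Re_part]
        bounded_linear_mult_right)
  then have "open {c. a < Re_part (u * c)}"
    by (intro open_Collect_less) (auto intro: continuous_on_const)
  then have "openin strong_operator_topology
      {f \<in> topspace strong_operator_topology. blinfun_apply f y \<in> {c. a < Re_part (u * c)}}"
    by (intro openin_continuous_map_preimage[OF strong_operator_topology_continuous_evaluation]) simp
  then show ?thesis
    unfolding weak_star_topology_def subtopology_subtopology openin_subtopology
    using assms by (force simp: strong_operator_topology_topspace)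
qed

section \<open>Uniform smoothness\<close>

lemma norm_sum_diff_le_modulus:
  fixes x y :: "'x::real_normed_vector"
  assumes "norm x = 1" "norm y \<le> t"
  shows "norm (x + y) + norm (x - y) \<le> 2 + 2 * modulus_of_smoothness TYPE('x) t"
proof -
  have "(norm (x + y) + norm (x - y) - 2) / 2 \<le> modulus_of_smoothness TYPE('x) t"
    unfolding modulus_of_smoothness_def
  proof (rule cSup_upper)
    \<comment> \<open>The triangle inequality bounds the set, so its \<open>Sup\<close> is a genuine
      supremum.\<close>
    have "(norm (x + y) + norm (x - y) - 2) / 2 \<le> t" if "norm x = 1" "norm y \<le> t" for x y :: 'x
      using norm_triangle_ineq[of x y] norm_triangle_ineq4[of x y] that by simp
    then show "bdd_above {(norm (x + y) + norm (x - y) - 2) / 2 |x y :: 'x. norm x = 1 \<and> norm y \<le> t}"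
      by (intro bdd_aboveI[of _ t]) blast
  qed (use assms in blast)
  then show ?thesis
    by simp
qed

text \<open>Adding \<open>Re f (x0 + y) \<le> norm (x0 + y)\<close> and
  \<open>Re g (x0 - y) \<le> norm (x0 - y)\<close> and using that \<open>f\<close> and
  \<open>g\<close> nearly attain 1 at \<open>x0\<close> bounds \<open>Re (f - g) y\<close> by twice
  the modulus plus \<open>2 * \<eta>\<close>, for all \<open>y\<close> of norm at most
  \<open>t\<close>. Dividing by \<open>t\<close> bounds the norm of \<open>f - g\<close>.\<close>

lemma uniformly_smooth_slices_small:
  fixes sX :: "'k::real_or_complex \<Rightarrow> 'x::banach \<Rightarrow> 'x"
  assumes X: "banach_space_over sX" and smooth: "uniformly_smooth TYPE('x)" and "0 < \<delta>"
  obtains \<eta> where "0 < \<eta>" "\<eta> \<le> 1"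
    "\<And>(x0 :: 'x) (f :: 'x \<Rightarrow>\<^sub>L 'k) g. \<lbrakk>norm x0 = 1; f \<in> dual_space sX; g \<in> dual_space sX;
        norm f \<le> 1; norm g \<le> 1; 1 - \<eta> < Re_part (blinfun_apply f x0);
        1 - \<eta> < Re_part (blinfun_apply g x0)\<rbrakk> \<Longrightarrow> norm (f - g) \<le> \<delta>"
proof -
  let ?\<rho> = "modulus_of_smoothness TYPE('x)"
  have "\<forall>\<^sub>F t in at_right 0. ?\<rho> t / t < \<delta> / 4"
    using smooth \<open>0 < \<delta>\<close> unfolding uniformly_smooth_def by (intro order_tendstoD(2)) auto
  then obtain b where b: "0 < b" "\<And>t. 0 < t \<Longrightarrow> t < b \<Longrightarrow> ?\<rho> t / t < \<delta> / 4"
    unfolding eventually_at_right_field by auto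
  define t where "t = b / 2"
  have t: "0 < t" and \<rho>_t: "?\<rho> t \<le> t * \<delta> / 4"
    using b(1) b(2)[of t] by (auto simp: t_def field_simps)
  show thesis
  proof
    \<comment> \<open>The modulus and \<open>\<eta>\<close> are each at most
      \<open>t * \<delta> / 4\<close>, so the doubled sum is at most \<open>t * \<delta>\<close>.
      The cap at 1 keeps \<open>1 - \<eta>\<close> non-negative, as a bound tested by a norming set
      must be.\<close>
    show "0 < min 1 (t * \<delta> / 4)" "min 1 (t * \<delta> / 4) \<le> 1"
      using t \<open>0 < \<delta>\<close> by auto
    fix x0 :: 'x and f g :: "'x \<Rightarrow>\<^sub>L 'k"
    assume x0: "norm x0 = 1" and fg: "f \<in> dual_space sX" "g \<in> dual_space sX"
      and norms: "norm f \<le> 1" "norm g \<le> 1"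
      and Re: "1 - min 1 (t * \<delta> / 4) < Re_part (blinfun_apply f x0)"
        "1 - min 1 (t * \<delta> / 4) < Re_part (blinfun_apply g x0)"
    have Re_le: "Re_part (blinfun_apply k x) \<le> norm x" if "norm k \<le> 1" for k :: "'x \<Rightarrow>\<^sub>L 'k" and x
      using Re_part_le_norm[of "blinfun_apply k x"] norm_blinfun[of k x]
        mult_right_mono[OF that norm_ge_zero[of x]] by linarith
    have small: "Re_part (blinfun_apply (f - g) y) \<le> t * \<delta>" if "norm y \<le> t" for y
      using Re_le[OF norms(1), of "x0 + y"] Re_le[OF norms(2), of "x0 - y"] Re \<rho>_t
        norm_sum_diff_le_modulus[OF x0 that] t \<open>0 < \<delta>\<close>
      by (simp add: blinfun.bilinear_simps Re_part_add Re_part_diff)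
    have "Re_part (blinfun_apply (f - g) x) \<le> \<delta> * norm x" for x
    proof (cases "x = 0")
      case True
      then show ?thesis
        using Re_part_of_real[of 0, where 'a='k] by simp
    next
      case False
      have "(t / norm x) * Re_part (blinfun_apply (f - g) x)
          = Re_part (blinfun_apply (f - g) ((t / norm x) *\<^sub>R x))"
        by (simp only: blinfun.scaleR_right linear_scale[OF bounded_linear.linear[OF bounded_linear_Re_part]]
            real_scaleR_def)
      also have "\<dots> \<le> t * \<delta>"
        using False t by (intro small) simp
      finally show ?thesis
        using False t by (simp add: field_simps)
    qed
    then have "norm (blinfun_apply (f - g) x) \<le> \<delta> * norm x" for x
      by (intro norm_le_of_Re_part_le[OF X])
        (simp_all add: blinfun.bilinear_simps dual_spaceD[OF fg(1)] dual_spaceD[OF fg(2)] algebra_simps)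
    then show "norm (f - g) \<le> \<delta>"
      using \<open>0 < \<delta>\<close> by (intro norm_blinfun_bound) auto
  qed
qed

section \<open>The perturbed operator\<close>

lemma dual_scale_dual_space: "f \<in> dual_space s \<Longrightarrow> dual_scale c f \<in> dual_space s"
  by (simp add: dual_space_def bounded_operators_def dual_scale_apply mult.left_commute)

lemma adjoint_op_dual_space:
  "\<lbrakk>T \<in> bounded_operators sX sY; f \<in> dual_space sY\<rbrakk> \<Longrightarrow> adjoint_op T f \<in> dual_space sX"
  by (simp add: dual_space_def bounded_operators_def adjoint_op_apply)

lemma norm_dual_scale_le: "norm (dual_scale c f) \<le> norm c * norm f"
proof (rule norm_blinfun_bound)
  show "norm (blinfun_apply (dual_scale c f) x) \<le> norm c * norm f * norm x" for x
    using mult_left_mono[OF norm_blinfun[of f x], of "norm c"]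
    by (simp add: dual_scale_apply norm_mult mult.assoc)
qed simp

lemma norm_blinfun_le:
  assumes "norm f \<le> b"
  shows "norm (blinfun_apply f x) \<le> b * norm x"
  using norm_blinfun[of f x] mult_right_mono[OF assms norm_ge_zero[of x]] by linarith

lemma bounded_linear_rank_one:
  fixes h :: "'x::real_normed_vector \<Rightarrow>\<^sub>L 'k::real_or_complex" and sY :: "'k \<Rightarrow> 'y::banach \<Rightarrow> 'y"
  assumes "banach_space_over sY"
  shows "bounded_linear (\<lambda>x. sY (blinfun_apply h x) y)"
proof -
  interpret Y: banach_space_over sY by fact
  show ?thesis
  proof (rule bounded_linear_intro[where K = "norm h * norm y"])
    show "sY (blinfun_apply h (a *\<^sub>R x)) y = a *\<^sub>R sY (blinfun_apply h x) y" for a x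
      by (simp add: blinfun.scaleR_right scaleR_conv_of_real Y.scale_of_real flip: Y.scale_scale)
    show "norm (sY (blinfun_apply h x) y) \<le> norm x * (norm h * norm y)" for x
      using mult_right_mono[OF norm_blinfun[of h x] norm_ge_zero[of y]]
      by (simp add: Y.norm_scale mult_ac)
  qed (simp add: blinfun.add_right Y.scale_left_distrib)
qed

text \<open>Here \<open>h\<close> is the common approximation of all \<open>f o T\<close> with
  \<open>f\<close> in \<open>V\<close>, with error \<open>\<delta>\<close>;
  \<open>\<epsilon>\<close> is the tolerance of the ACK condition and \<open>\<kappa>\<close> the
  size of the perturbation. The assumption \<open>small\<close> makes the gain
  \<open>\<kappa> * (1 - \<rho>)\<close> off \<open>V_1\<close> absorb all approximation
  errors.\<close>

locale ACK_perturbation =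
  fixes sX :: "'k::real_or_complex \<Rightarrow> 'x::banach \<Rightarrow> 'x" and sY :: "'k \<Rightarrow> 'y::banach \<Rightarrow> 'y"
    and \<Gamma> V :: "('y \<Rightarrow>\<^sub>L 'k) set" and F :: "'y \<Rightarrow>\<^sub>L 'y" and e :: 'y
    and T :: "'x \<Rightarrow>\<^sub>L 'y" and h :: "'x \<Rightarrow>\<^sub>L 'k" and \<rho> \<kappa> \<epsilon> \<delta> :: real
  assumes Y: "banach_space_over sY"
    and \<Gamma>: "one_norming sY \<Gamma>"
    and F: "F \<in> bounded_operators sY sY" and T: "T \<in> bounded_operators sX sY"
    and h: "h \<in> dual_space sX"
    and norm_T: "norm T \<le> 1" and norm_h: "norm h \<le> 1"
    and norm_e: "norm e \<le> 1" and norm_Fe: "norm (blinfun_apply F e) \<le> 1"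
    and off_V1: "\<And>f. \<lbrakk>f \<in> \<Gamma>; 1 < norm (adjoint_op F f) + (1 - \<epsilon>) * norm (f - adjoint_op F f)\<rbrakk>
        \<Longrightarrow> norm (blinfun_apply f (blinfun_apply F e)) \<le> \<rho>"
    and near_V: "\<And>f. f \<in> \<Gamma> \<Longrightarrow> infdist (adjoint_op F f) (aconv dual_scale ({0} \<union> V)) < \<epsilon>"
    and V_e: "\<And>f. f \<in> V \<Longrightarrow> norm (blinfun_apply f e - 1) \<le> \<epsilon>"
    and V_T: "\<And>f x. f \<in> V \<Longrightarrow> norm (blinfun_apply f (blinfun_apply T x) - blinfun_apply h x) \<le> \<delta> * norm x"
    and \<kappa>: "0 < \<kappa>" "\<kappa> < 1" and \<epsilon>: "0 < \<epsilon>" "\<epsilon> \<le> \<kappa>" and \<delta>: "0 < \<delta>"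
    and small: "\<delta> + 3 * \<epsilon> \<le> \<kappa> * (1 - \<rho>)" and \<rho>: "0 \<le> \<rho>"
begin

text \<open>Functionals fixed by the adjoint of \<open>F\<close> annihilate
  \<open>T - F o T\<close>, so on them only the rank-one term counts. The factor
  \<open>1 - \<kappa>\<close> leaves room for errors off \<open>V_1\<close> and stays below the
  weight \<open>1 - \<epsilon>\<close> on \<open>V_1\<close>.\<close>

definition S :: "'x \<Rightarrow>\<^sub>L 'y" where
  "S = Blinfun (\<lambda>x. sY (blinfun_apply h x) (blinfun_apply F e)) + (1 - \<kappa>) *\<^sub>R (T - (F o\<^sub>L T))"

lemma S_apply:
  "blinfun_apply S x = sY (blinfun_apply h x) (blinfun_apply F e)
     + (1 - \<kappa>) *\<^sub>R (blinfun_apply T x - blinfun_apply F (blinfun_apply T x))"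
  by (simp add: S_def blinfun.bilinear_simps bounded_linear_Blinfun_apply[OF bounded_linear_rank_one[OF Y]])

lemma S_bounded_operators: "S \<in> bounded_operators sX sY"
proof -
  interpret Y: banach_space_over sY by (rule Y)
  have "sY c (a *\<^sub>R y) = a *\<^sub>R sY c y" for c a y
    by (metis Y.scale_of_real Y.scale_left_commute)
  then show ?thesis
    by (simp add: bounded_operators_def S_apply dual_spaceD[OF h] bounded_operatorsD[OF T]
        bounded_operatorsD[OF F] Y.scale_right_distrib Y.scale_right_diff_distrib)
qed

lemma \<Gamma>_dual: "f \<in> \<Gamma> \<Longrightarrow> f \<in> dual_space sY" and \<Gamma>_norm: "f \<in> \<Gamma> \<Longrightarrow> norm f \<le> 1"
  using \<Gamma> by (auto simp: one_norming_def)

lemma functional_S: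
  assumes "f \<in> dual_space sY"
  shows "blinfun_apply f (blinfun_apply S x) = blinfun_apply h x * blinfun_apply f (blinfun_apply F e)
     + (1 - \<kappa>) *\<^sub>R (blinfun_apply f (blinfun_apply T x) - blinfun_apply f (blinfun_apply F (blinfun_apply T x)))"
  by (simp add: S_apply blinfun.bilinear_simps dual_spaceD[OF assms])

text \<open>Replace the adjoint image of \<open>f\<close> by a nearby \<open>v\<close> in the hull
  of \<open>{0} \<union> V\<close>. The replacement costs \<open>\<epsilon>\<close> at
  \<open>T x\<close> and \<open>\<epsilon>\<close> at \<open>e\<close>; the claim for
  \<open>v\<close> itself costs \<open>\<delta> + \<epsilon>\<close>.\<close>

lemma functional_FT_approx:
  assumes f: "f \<in> \<Gamma>"
  shows "norm (blinfun_apply f (blinfun_apply F (blinfun_apply T x))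
      - blinfun_apply f (blinfun_apply F e) * blinfun_apply h x) \<le> (\<delta> + 3 * \<epsilon>) * norm x"
proof -
  \<comment> \<open>Nonemptiness comes first, because \<open>infdist\<close> to the empty set is 0
    by convention and would yield no \<open>v\<close>.\<close>
  have "{0} \<union> V \<subseteq> aconv dual_scale ({0} \<union> V)"
    unfolding aconv_def by (rule hull_subset)
  then have ne: "aconv dual_scale ({0} \<union> V) \<noteq> {}"
    by blast
  then have "(INF v\<in>aconv dual_scale ({0} \<union> V). dist (adjoint_op F f) v) < \<epsilon>"
    using near_V[OF f] by (simp add: infdist_notempty)
  then obtain v where v: "v \<in> aconv dual_scale ({0} \<union> V)" "dist (adjoint_op F f) v < \<epsilon>"
    using ne by (subst (asm) cINF_less_iff) (auto intro!: bdd_belowI2[where m = 0])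
  \<comment> \<open>This map measures how far \<open>v o T\<close> is from \<open>v e\<close> times
    \<open>h\<close>. Being linear in \<open>v\<close>, it need only be bounded on \<open>V\<close>
    and at 0; on \<open>V\<close> the value \<open>v e\<close> is close to 1 and
    \<open>v o T\<close> is close to \<open>h\<close>.\<close>
  let ?\<phi> = "\<lambda>v. blinfun_apply v (blinfun_apply T x) - blinfun_apply v e * blinfun_apply h x"
  have "norm (?\<phi> v) \<le> (\<delta> + \<epsilon>) * norm x"
  proof (rule aconv_norm_le[OF _ _ _ _ v(1)])
    show "linear ?\<phi>"
      by (rule linearI) (simp_all add: blinfun.bilinear_simps algebra_simps)
    show "norm (?\<phi> (dual_scale c f)) \<le> norm c * norm (?\<phi> f)" for c f
      by (simp add: dual_scale_apply norm_mult[symmetric] algebra_simps)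
    show "0 \<le> (\<delta> + \<epsilon>) * norm x"
      using \<delta> \<epsilon> by simp
    show "norm (?\<phi> f) \<le> (\<delta> + \<epsilon>) * norm x" if "f \<in> {0} \<union> V" for f
    proof (cases "f \<in> V")
      case True
      have "norm ((blinfun_apply f e - 1) * blinfun_apply h x) \<le> \<epsilon> * (1 * norm x)"
        unfolding norm_mult using V_e[OF True] norm_blinfun_le[OF norm_h, of x] \<epsilon>
        by (intro mult_mono) auto
      moreover have "?\<phi> f = (blinfun_apply f (blinfun_apply T x) - blinfun_apply h x)
          - (blinfun_apply f e - 1) * blinfun_apply h x"
        by (simp add: algebra_simps)
      ultimately show ?thesis
        using V_T[OF True, of x] by (simp only: distrib_right mult_1_left add_mono order_trans[OF norm_triangle_ineq4])
    next
      case False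
      with that \<delta> \<epsilon> show ?thesis
        by simp
    qed
  qed
  then have 1: "norm (?\<phi> v) \<le> \<delta> * norm x + \<epsilon> * norm x"
    by (simp add: distrib_right)
  have F_v: "norm (blinfun_apply (adjoint_op F f - v) y) \<le> \<epsilon> * norm y" for y
    using v(2) by (intro norm_blinfun_le) (simp add: dist_norm)
  have 2: "norm (blinfun_apply (adjoint_op F f - v) (blinfun_apply T x)) \<le> \<epsilon> * norm x"
    using norm_blinfun_le[OF norm_T, of x] \<epsilon> by (intro order_trans[OF F_v] mult_left_mono) auto
  have "norm (blinfun_apply (adjoint_op F f - v) e) \<le> \<epsilon> * 1"
    using norm_e \<epsilon> by (intro order_trans[OF F_v] mult_left_mono) auto
  then have 3: "norm (blinfun_apply (adjoint_op F f - v) e * blinfun_apply h x) \<le> \<epsilon> * (1 * norm x)"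
    unfolding norm_mult using norm_blinfun_le[OF norm_h, of x] \<epsilon>
    by (intro mult_mono) auto
  have "blinfun_apply f (blinfun_apply F (blinfun_apply T x))
      - blinfun_apply f (blinfun_apply F e) * blinfun_apply h x
      = ?\<phi> v + blinfun_apply (adjoint_op F f - v) (blinfun_apply T x)
        - blinfun_apply (adjoint_op F f - v) e * blinfun_apply h x"
    by (simp add: blinfun.bilinear_simps adjoint_op_apply algebra_simps)
  also have "norm \<dots> \<le> (\<delta> * norm x + \<epsilon> * norm x) + \<epsilon> * norm x + \<epsilon> * (1 * norm x)"
    by (intro order_trans[OF norm_triangle_ineq4] norm_triangle_le add_mono 1 2 3)
  finally show ?thesis
    by (simp add: distrib_right)
qed

text \<open>Substituting the approximation of \<open>f o F o T\<close> shows \<open>f o S\<close> as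
  nearly a convex combination; this serves both the norm bound and the distance bound. The remainder
  is the approximation error times \<open>\<kappa> - 1\<close>.\<close>

lemma functional_S_decomposition:
  assumes f: "f \<in> \<Gamma>"
  obtains r where "norm r \<le> (\<delta> + 3 * \<epsilon>) * norm x"
    "blinfun_apply f (blinfun_apply S x) = (1 - \<kappa>) *\<^sub>R blinfun_apply f (blinfun_apply T x)
       + \<kappa> *\<^sub>R (blinfun_apply f (blinfun_apply F e) * blinfun_apply h x) + r"
proof
  let ?r = "blinfun_apply f (blinfun_apply F (blinfun_apply T x))
      - blinfun_apply f (blinfun_apply F e) * blinfun_apply h x"
  have "norm ((\<kappa> - 1) *\<^sub>R ?r) \<le> 1 * norm ?r"
    unfolding norm_scaleR using \<kappa> by (intro mult_right_mono) auto
  then show "norm ((\<kappa> - 1) *\<^sub>R ?r) \<le> (\<delta> + 3 * \<epsilon>) * norm x"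
    using functional_FT_approx[OF f, of x] by simp
  show "blinfun_apply f (blinfun_apply S x) = (1 - \<kappa>) *\<^sub>R blinfun_apply f (blinfun_apply T x)
       + \<kappa> *\<^sub>R (blinfun_apply f (blinfun_apply F e) * blinfun_apply h x) + (\<kappa> - 1) *\<^sub>R ?r"
    by (simp add: functional_S[OF \<Gamma>_dual[OF f]] algebra_simps)
qed

lemma functional_S_le:
  assumes f: "f \<in> \<Gamma>"
  shows "norm (blinfun_apply f (blinfun_apply S x)) \<le> norm x"
proof (cases "1 < norm (adjoint_op F f) + (1 - \<epsilon>) * norm (f - adjoint_op F f)")
  case True
  obtain r where r: "norm r \<le> (\<delta> + 3 * \<epsilon>) * norm x"
    "blinfun_apply f (blinfun_apply S x) = (1 - \<kappa>) *\<^sub>R blinfun_apply f (blinfun_apply T x)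
       + \<kappa> *\<^sub>R (blinfun_apply f (blinfun_apply F e) * blinfun_apply h x) + r"
    using functional_S_decomposition[OF f] .
  have "norm (blinfun_apply f (blinfun_apply T x)) \<le> norm x"
    using norm_blinfun_le[OF \<Gamma>_norm[OF f], of "blinfun_apply T x"] norm_blinfun_le[OF norm_T, of x] by simp
  then have 1: "norm ((1 - \<kappa>) *\<^sub>R blinfun_apply f (blinfun_apply T x)) \<le> (1 - \<kappa>) * norm x"
    using \<kappa> by (simp add: mult_left_mono)
  have "norm (blinfun_apply f (blinfun_apply F e) * blinfun_apply h x) \<le> \<rho> * (1 * norm x)"
    unfolding norm_mult using off_V1[OF f True] norm_blinfun_le[OF norm_h, of x] \<rho>
    by (intro mult_mono) auto
  then have 2: "norm (\<kappa> *\<^sub>R (blinfun_apply f (blinfun_apply F e) * blinfun_apply h x)) \<le> \<kappa> * (\<rho> * norm x)"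
    using \<kappa> by (simp add: mult_left_mono)
  have "norm (blinfun_apply f (blinfun_apply S x))
      \<le> (1 - \<kappa>) * norm x + \<kappa> * (\<rho> * norm x) + (\<delta> + 3 * \<epsilon>) * norm x"
    unfolding r(2) by (intro norm_triangle_le add_mono 1 2 r(1))
  \<comment> \<open>The error is absorbed here: the three coefficients add up to exactly 1.\<close>
  also have "\<dots> \<le> (1 - \<kappa>) * norm x + \<kappa> * (\<rho> * norm x) + (\<kappa> * (1 - \<rho>)) * norm x"
    using mult_right_mono[OF small norm_ge_zero[of x]] by simp
  also have "\<dots> = norm x"
    by (simp add: algebra_simps)
  finally show ?thesis .
next
  case False
  have "norm (blinfun_apply (adjoint_op F f) e) \<le> norm (adjoint_op F f)"
    using norm_blinfun[of "adjoint_op F f" e] mult_left_mono[OF norm_e norm_ge_zero[of "adjoint_op F f"]] by simp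
  then have 1: "norm (blinfun_apply h x * blinfun_apply f (blinfun_apply F e)) \<le> (1 * norm x) * norm (adjoint_op F f)"
    unfolding norm_mult adjoint_op_apply using norm_blinfun_le[OF norm_h, of x] by (intro mult_mono) auto
  have "norm (blinfun_apply (f - adjoint_op F f) (blinfun_apply T x)) \<le> norm (f - adjoint_op F f) * norm x"
    using norm_blinfun[of "f - adjoint_op F f" "blinfun_apply T x"]
      mult_left_mono[OF norm_blinfun_le[OF norm_T, of x] norm_ge_zero[of "f - adjoint_op F f"]] by simp
  \<comment> \<open>Since \<open>\<epsilon> \<le> \<kappa>\<close>, the factor
    \<open>1 - \<kappa>\<close> may be raised to the weight \<open>1 - \<epsilon>\<close> that
    occurs in the definition of \<open>V_1\<close>.\<close>
  then have 2: "norm ((1 - \<kappa>) *\<^sub>R (blinfun_apply f (blinfun_apply T x) - blinfun_apply f (blinfun_apply F (blinfun_apply T x))))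
      \<le> (1 - \<epsilon>) * (norm (f - adjoint_op F f) * norm x)"
    unfolding norm_scaleR using \<kappa> \<epsilon>
    by (intro mult_mono) (auto simp: blinfun.diff_left adjoint_op_apply)
  have "norm (blinfun_apply f (blinfun_apply S x))
      \<le> (1 * norm x) * norm (adjoint_op F f) + (1 - \<epsilon>) * (norm (f - adjoint_op F f) * norm x)"
    unfolding functional_S[OF \<Gamma>_dual[OF f]] by (intro norm_triangle_le add_mono 1 2)
  also have "\<dots> = (norm (adjoint_op F f) + (1 - \<epsilon>) * norm (f - adjoint_op F f)) * norm x"
    by (simp add: algebra_simps)
  also have "\<dots> \<le> 1 * norm x"
    using False by (intro mult_right_mono) auto
  finally show ?thesis
    by simp
qed

lemma norm_S_le: "norm S \<le> 1"
  by (rule norm_blinfun_bound) (auto intro!: one_norming_norm_le[OF Y \<Gamma>] functional_S_le)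

text \<open>The main part of the difference is \<open>\<kappa>\<close> times two terms of norm at
  most \<open>norm x\<close>; the remainder contributes one more \<open>\<kappa>\<close>.\<close>

lemma functional_S_diff_le:
  assumes f: "f \<in> \<Gamma>"
  shows "norm (blinfun_apply f (blinfun_apply (S - T) x)) \<le> 3 * \<kappa> * norm x"
proof -
  obtain r where r: "norm r \<le> (\<delta> + 3 * \<epsilon>) * norm x"
    "blinfun_apply f (blinfun_apply S x) = (1 - \<kappa>) *\<^sub>R blinfun_apply f (blinfun_apply T x)
       + \<kappa> *\<^sub>R (blinfun_apply f (blinfun_apply F e) * blinfun_apply h x) + r"
    using functional_S_decomposition[OF f] .
  have eq: "blinfun_apply f (blinfun_apply (S - T) x)
      = \<kappa> *\<^sub>R (blinfun_apply f (blinfun_apply F e) * blinfun_apply h x - blinfun_apply f (blinfun_apply T x)) + r"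
    by (simp add: blinfun.bilinear_simps r(2) algebra_simps)
  have 1: "norm (blinfun_apply f (blinfun_apply T x)) \<le> norm x"
    using norm_blinfun_le[OF \<Gamma>_norm[OF f], of "blinfun_apply T x"] norm_blinfun_le[OF norm_T, of x] by simp
  have "norm (blinfun_apply f (blinfun_apply F e)) \<le> 1"
    using norm_blinfun_le[OF \<Gamma>_norm[OF f], of "blinfun_apply F e"] norm_Fe by simp
  then have 2: "norm (blinfun_apply f (blinfun_apply F e) * blinfun_apply h x) \<le> 1 * (1 * norm x)"
    unfolding norm_mult using norm_blinfun_le[OF norm_h, of x] by (intro mult_mono) auto
  have "norm (blinfun_apply f (blinfun_apply F e) * blinfun_apply h x - blinfun_apply f (blinfun_apply T x)) \<le> 2 * norm x"
    using norm_triangle_ineq4[of "blinfun_apply f (blinfun_apply F e) * blinfun_apply h x" "blinfun_apply f (blinfun_apply T x)"] 1 2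
    by simp
  then have 3: "norm (\<kappa> *\<^sub>R (blinfun_apply f (blinfun_apply F e) * blinfun_apply h x - blinfun_apply f (blinfun_apply T x)))
      \<le> \<kappa> * (2 * norm x)"
    using \<kappa> by (simp add: mult_left_mono)
  have "\<kappa> * (1 - \<rho>) \<le> \<kappa>"
    using \<kappa> \<rho> by (simp add: mult_left_le)
  with small have "\<delta> + 3 * \<epsilon> \<le> \<kappa>"
    by simp
  then have "norm r \<le> \<kappa> * norm x"
    by (rule order_trans[OF r(1) mult_right_mono]) simp
  then have "norm (blinfun_apply f (blinfun_apply (S - T) x)) \<le> \<kappa> * (2 * norm x) + \<kappa> * norm x"
    unfolding eq by (intro norm_triangle_le add_mono 3)
  then show ?thesis
    by simp
qed

lemma norm_S_diff_le: "norm (S - T) \<le> 3 * \<kappa>"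
proof (rule norm_blinfun_bound)
  show "norm (blinfun_apply (S - T) x) \<le> 3 * \<kappa> * norm x" for x
    using \<kappa> by (intro one_norming_norm_le[OF Y \<Gamma>] functional_S_diff_le) auto
qed (use \<kappa> in simp)

text \<open>The functional \<open>y1\<close> annihilates \<open>T - F o T\<close> and is 1 at
  \<open>F e\<close>, so \<open>y1 (S x0) = h x0\<close>, of modulus 1.\<close>

lemma S_attains_norm:
  assumes "y1 \<in> \<Gamma>" "adjoint_op F y1 = y1" "blinfun_apply y1 (blinfun_apply F e) = 1"
    and "norm x0 = 1" "norm (blinfun_apply h x0) = 1"
  shows "norm S = 1" "norm (blinfun_apply S x0) = 1"
proof -
  have "blinfun_apply y1 (blinfun_apply F y) = blinfun_apply y1 y" for y
    by (metis adjoint_op_apply assms(2))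
  then have "blinfun_apply y1 (blinfun_apply S x0) = blinfun_apply h x0"
    using functional_S[OF \<Gamma>_dual[OF assms(1)], of x0] assms(3) by simp
  then have "1 \<le> norm (blinfun_apply S x0)"
    using norm_blinfun_le[OF \<Gamma>_norm[OF assms(1)], of "blinfun_apply S x0"] assms(5) by simp
  then show "norm S = 1" "norm (blinfun_apply S x0) = 1"
    using norm_blinfun[of S x0] norm_S_le assms(4) by auto
qed

end

section \<open>Choice of the constants and of the slice, and verification of the BPB
  property\<close>

theorem proposition4p2:
  fixes sY :: "'k::real_or_complex \<Rightarrow> 'y::banach \<Rightarrow> 'y" and \<rho> :: real
  assumes "0 \<le> \<rho>" and "\<rho> < 1"
    and "banach_space_over sY"
    and "ACK_structure \<rho> sY"
  shows "universal_pointwise_BPB_range TYPE('x::banach) sY"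
  unfolding universal_pointwise_BPB_range_def pointwise_BPB_def
proof (intro allI impI, elim conjE)
  fix sX :: "'k \<Rightarrow> 'x \<Rightarrow> 'x" and \<epsilon>0 :: real
  assume X: "banach_space_over sX" and smooth: "uniformly_smooth TYPE('x)" and "0 < \<epsilon>0"
  obtain \<Gamma> :: "('y \<Rightarrow>\<^sub>L 'k) set" where \<Gamma>: "one_norming sY \<Gamma>"
    and ACK: "\<forall>\<epsilon>>0. \<forall>U. openin (subtopology (weak_star_topology sY) \<Gamma>) U \<and> U \<noteq> {} \<longrightarrow>
         (\<exists>V y1 e. \<exists>F \<in> bounded_operators sY sY.
            V \<noteq> {} \<and> V \<subseteq> U \<and> y1 \<in> V \<and> norm e = 1 \<and>
            norm (blinfun_apply F e) = 1 \<and> norm F = 1 \<and>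
            blinfun_apply y1 (blinfun_apply F e) = 1 \<and>
            adjoint_op F y1 = y1 \<and>
            (let V\<^sub>1 = {f \<in> \<Gamma>. norm (adjoint_op F f) + (1 - \<epsilon>) * norm (f - adjoint_op F f) \<le> 1}
             in \<forall>f \<in> \<Gamma> - V\<^sub>1. norm (blinfun_apply f (blinfun_apply F e)) \<le> \<rho>) \<and>
            (\<forall>f\<in>\<Gamma>. infdist (adjoint_op F f) (aconv dual_scale ({0} \<union> V)) < \<epsilon>) \<and>
            (\<forall>f\<in>V. norm (blinfun_apply f e - 1) \<le> \<epsilon>))"
    using assms(4) unfolding ACK_structure_def by blast
  have \<Gamma>_dual: "f \<in> dual_space sY" and \<Gamma>_norm: "norm f \<le> 1" if "f \<in> \<Gamma>" for f
    using \<Gamma> that by (auto simp: one_norming_def)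
  \<comment> \<open>The distance from \<open>S\<close> to \<open>T\<close> will be at most
    \<open>3 * \<kappa>\<close>, hence below \<open>\<epsilon>0\<close>.\<close>
  define \<kappa> where "\<kappa> = min (1 / 2) (\<epsilon>0 / 4)"
  have \<kappa>: "0 < \<kappa>" "\<kappa> < 1" and \<kappa>_lt: "3 * \<kappa> < \<epsilon>0"
    using \<open>0 < \<epsilon>0\<close> by (auto simp: \<kappa>_def min_def)
  \<comment> \<open>Slices of diameter \<open>3 * \<epsilon>\<close> and the error
    \<open>3 * \<epsilon>\<close> together use up exactly
    \<open>\<kappa> * (1 - \<rho>)\<close>.\<close>
  define \<epsilon> where "\<epsilon> = \<kappa> * (1 - \<rho>) / 6"
  have \<kappa>\<rho>: "0 < \<kappa> * (1 - \<rho>)" "\<kappa> * (1 - \<rho>) \<le> \<kappa>"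
    using \<kappa> assms by (auto simp: mult_left_le)
  then have \<epsilon>: "0 < \<epsilon>" "\<epsilon> \<le> \<kappa>"
    using \<kappa> unfolding \<epsilon>_def by linarith+
  obtain \<eta> where \<eta>: "0 < \<eta>" "\<eta> \<le> 1"
    and slices: "\<And>(x0 :: 'x) (f :: 'x \<Rightarrow>\<^sub>L 'k) g. \<lbrakk>norm x0 = 1; f \<in> dual_space sX; g \<in> dual_space sX;
        norm f \<le> 1; norm g \<le> 1; 1 - \<eta> < Re_part (blinfun_apply f x0);
        1 - \<eta> < Re_part (blinfun_apply g x0)\<rbrakk> \<Longrightarrow> norm (f - g) \<le> 3 * \<epsilon>"
    using uniformly_smooth_slices_small[OF X smooth, of "3 * \<epsilon>"] \<epsilon>(1) by auto
  show "\<exists>\<eta>>0. \<forall>T\<in>bounded_operators sX sY. \<forall>x0.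
      norm T = 1 \<and> norm x0 = 1 \<and> 1 - \<eta> < norm (blinfun_apply T x0) \<longrightarrow>
      (\<exists>S\<in>bounded_operators sX sY. norm S = 1 \<and> norm (blinfun_apply S x0) = 1 \<and> norm (S - T) < \<epsilon>0)"
  proof (intro exI[of _ \<eta>] conjI ballI allI impI \<eta>(1), elim conjE)
    fix T x0
    assume T: "T \<in> bounded_operators sX sY" and norm_T: "norm T = 1" and x0: "norm x0 = 1"
      and Tx0: "1 - \<eta> < norm (blinfun_apply T x0)"
    \<comment> \<open>Otherwise the norming property would bound the norm of \<open>T x0\<close> by
      \<open>1 - \<eta>\<close>. The functional \<open>f0\<close> and its phase \<open>u\<close>
      make the slice \<open>U\<close> non-empty.\<close>
    obtain f0 where f0: "f0 \<in> \<Gamma>" "1 - \<eta> < norm (blinfun_apply f0 (blinfun_apply T x0))"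
      using one_norming_norm_le[OF assms(3) \<Gamma>, of "1 - \<eta>" "blinfun_apply T x0"] Tx0 \<eta>(2) by force
    obtain u where u: "norm u = 1" "u * blinfun_apply f0 (blinfun_apply T x0)
        = of_real (norm (blinfun_apply f0 (blinfun_apply T x0)))"
      by (rule unimodular_phase)
    define U where "U = {f \<in> \<Gamma>. 1 - \<eta> < Re_part (u * blinfun_apply f (blinfun_apply T x0))}"
    have "openin (subtopology (weak_star_topology sY) \<Gamma>) U"
      unfolding U_def by (rule openin_weak_star_slice) (use \<Gamma>_dual in blast)
    moreover have "f0 \<in> U"
      using f0 u(2) by (simp add: U_def Re_part_of_real)
    ultimately have "openin (subtopology (weak_star_topology sY) \<Gamma>) U \<and> U \<noteq> {}"
      by blast
    note ACK[THEN spec, THEN mp, OF \<epsilon>(1), THEN spec, THEN mp, OF this, unfolded Let_def]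
    then obtain V y1 e F where F: "F \<in> bounded_operators sY sY" and V: "V \<subseteq> U" "y1 \<in> V"
      and norms: "norm e = 1" "norm (blinfun_apply F e) = 1"
      and y1: "blinfun_apply y1 (blinfun_apply F e) = 1" "adjoint_op F y1 = y1"
      and off_V1: "\<forall>f \<in> \<Gamma> - {f \<in> \<Gamma>. norm (adjoint_op F f) + (1 - \<epsilon>) * norm (f - adjoint_op F f) \<le> 1}.
          norm (blinfun_apply f (blinfun_apply F e)) \<le> \<rho>"
      and near_V: "\<forall>f\<in>\<Gamma>. infdist (adjoint_op F f) (aconv dual_scale ({0} \<union> V)) < \<epsilon>"
      and V_e: "\<forall>f\<in>V. norm (blinfun_apply f e - 1) \<le> \<epsilon>"
      by (elim exE bexE conjE) (rule that)
    obtain g :: "'x \<Rightarrow>\<^sub>L 'k" where g: "g \<in> dual_space sX" "norm g \<le> 1"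
        "Re_part (blinfun_apply g x0) = 1"
      using norming_functional[OF X, of x0] x0 by metis
    have u_ne: "u \<noteq> 0"
      using u(1) by auto
    \<comment> \<open>For \<open>f\<close> in \<open>U\<close>, both \<open>u\<close> times
      \<open>f o T\<close> and \<open>g\<close> lie in the slice of the dual ball at
      \<open>x0\<close>. Dividing by \<open>u\<close> makes one \<open>h\<close> serve all of
      \<open>V\<close>, and keeps modulus 1 at \<open>x0\<close>.\<close>
    define h where "h = dual_scale (inverse u) g"
    have norm_h_apply: "norm (blinfun_apply h x) = norm (blinfun_apply g x)" for x
      by (simp add: h_def dual_scale_apply norm_mult norm_inverse u(1))
    have V_T: "norm (blinfun_apply f (blinfun_apply T x) - blinfun_apply h x) \<le> (3 * \<epsilon>) * norm x"
      if "f \<in> V" for f x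
    proof -
      let ?k = "dual_scale u (adjoint_op T f)"
      have f: "f \<in> \<Gamma>" "1 - \<eta> < Re_part (u * blinfun_apply f (blinfun_apply T x0))"
        using that V(1) by (auto simp: U_def)
      have "norm (adjoint_op T f) \<le> norm f * norm T"
        unfolding adjoint_op_def by (rule norm_blinfun_compose)
      then have "norm ?k \<le> 1"
        using norm_dual_scale_le[of u "adjoint_op T f"] \<Gamma>_norm[OF f(1)] u(1) norm_T by simp
      then have "norm (?k - g) \<le> 3 * \<epsilon>"
        using f g x0 \<eta>(1) T \<Gamma>_dual[OF f(1)]
        by (intro slices[of x0])
          (auto simp: dual_scale_apply adjoint_op_apply intro: dual_scale_dual_space adjoint_op_dual_space)
      then have "norm (blinfun_apply (?k - g) x) \<le> (3 * \<epsilon>) * norm x"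
        by (rule norm_blinfun_le)
      moreover have "blinfun_apply f (blinfun_apply T x) - blinfun_apply h x
          = inverse u * blinfun_apply (?k - g) x"
        using u_ne by (simp add: h_def dual_scale_apply adjoint_op_apply blinfun.diff_left field_simps)
      ultimately show ?thesis
        by (simp add: norm_mult norm_inverse u(1))
    qed
    interpret ACK_perturbation sX sY \<Gamma> V F e T h \<rho> \<kappa> \<epsilon> "3 * \<epsilon>"
    proof (rule ACK_perturbation.intro)
      show "h \<in> dual_space sX"
        unfolding h_def by (rule dual_scale_dual_space[OF g(1)])
      show "norm h \<le> 1"
        using norm_dual_scale_le[of "inverse u" g] g(2) u(1) by (simp add: h_def norm_inverse)
      show "3 * \<epsilon> + 3 * \<epsilon> \<le> \<kappa> * (1 - \<rho>)"
        by (simp add: \<epsilon>_def)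
      show "norm (blinfun_apply f (blinfun_apply F e)) \<le> \<rho>"
        if "f \<in> \<Gamma>" "1 < norm (adjoint_op F f) + (1 - \<epsilon>) * norm (f - adjoint_op F f)" for f
        using off_V1 that by auto
    qed (use assms \<Gamma> F T norm_T norms near_V V_e V_T \<kappa> \<epsilon> in auto)
    have "1 \<le> norm (blinfun_apply g x0)"
      using Re_part_le_norm[of "blinfun_apply g x0"] g(3) by simp
    then have "norm (blinfun_apply h x0) = 1"
      using norm_blinfun_le[OF g(2), of x0] x0 by (simp add: norm_h_apply)
    then have "norm S = 1" "norm (blinfun_apply S x0) = 1"
      using S_attains_norm[OF _ y1(2,1) x0] V by (auto simp: U_def)
    moreover have "norm (S - T) < \<epsilon>0"
      using norm_S_diff_le \<kappa>_lt by simp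
    ultimately show "\<exists>S\<in>bounded_operators sX sY. norm S = 1 \<and> norm (blinfun_apply S x0) = 1 \<and> norm (S - T) < \<epsilon>0"
      using S_bounded_operators by blast
  qed
qed

end
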